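(* $\mathsf{G3E}$ is label-preserving equivalent to $\mathsf{LbNS}_{\mathsf{E}}$, and $\mathsf{G3M}$ is label-preserving equivalent to $\mathsf{LbNS}_{\mathsf{M}}$: for all multisets $X,Y$ of labelled formulae, $X\vdash Y$ (with no relational/neighbourhood atoms) is derivable in $\mathsf{G3E}$ (resp. $\mathsf{G3M}$) iff it is derivable in $\mathsf{LbNS}_{\mathsf{E}}$ (resp. $\mathsf{LbNS}_{\mathsf{M}}$), with the labels of formulae preserved.
   Context: Formulae: classical propositional with one modality $\Box$. All four systems contain the standard single-label classical propositional rules and axioms ($x\!:\!P\vdash x\!:\!P$, $x\!:\!\bot\vdash$ with contexts). $\mathsf{LbNS}_{\mathsf{E}}$: sequents $\mathcal{N},X\vdash Y$ with $\mathcal{N}$ a set of relation terms $xNy$ and $xN_{\mathsf{e}}(y_1,y_2)$ over state variables; modal rules: from $\mathcal{N},xN_{\mathsf{e}}(y_1,y_2),X,y_2\!:\!B\vdash y_1\!:\!B,Y$ infer $\mathcal{N},X\vdash Y,x\!:\!\Box B$ ($y_1,y_2$ fresh); from $\mathcal{N},xNy_1,y_1\!:\!A,X\vdash Y$ and $\mathcal{N},xNy_2,X\vdash Y,y_2\!:\!A$ infer $\mathcal{N},xN_{\mathsf{e}}(y_1,y_2),x\!:\!\Box A,X\vdash Y$. $\mathsf{LbNS}_{\mathsf{M}}$ additionally has: from $\mathcal{N},xN_{\mathsf{e}}(y_1,y_2),X,y_2\!:\!\bot\vdash Y$ infer $\mathcal{N},xN_{\mathsf{e}}(y_1,y_2),X\vdash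 Y$. $\mathsf{G3E}$ and $\mathsf{G3M}$ are labelled calculi based on neighbourhood semantics, with world labels $x,y,z$, neighbourhood labels $a$, and atoms $a\in N(x)$, $x\in a$, $a\Vdash^{\forall}A$ (all worlds of $a$ force $A$), $A\lhd a$ (every world forcing $A$ is in $a$). Common rules: $\Vdash^{\forall}$: from $x\in a,x\!:\!A,a\Vdash^{\forall}A,X\vdash Y$ infer $x\in a,a\Vdash^{\forall}A,X\vdash Y$; axiom $x\in a,X\vdash Y,x\in a$. $\mathsf{G3E}$ also has $\lhd$: from $A\lhd a,X\vdash Y,z\!:\!A$ and $z\in a,A\lhd a,X\vdash Y$ infer $A\lhd a,X\vdash Y$ ($z$ arbitrary); $\Box_L^{\mathsf{e}}$: from $a\in N(x),a\Vdash^{\forall}A,A\lhd a,X\vdash Y$ infer $x\!:\!\Box A,X\vdash Y$ ($a$ fresh); $\Box_R^{\mathsf{e}}$: from $z\in a,a\in N(x),X\vdash Y,x\!:\!\Box B,z\!:\!B$ and $y\!:\!B,a\in N(x),X\vdash Y,x\!:\!\Box B,y\in a$ infer $a\in N(x),X\vdash Y,x\!:\!\Box B$ ($y,z$ fresh). $\mathsf{G3M}$ instead has $\Box_L^{\mathsf{m}}$: from $a\in N(x),a\Vdash^{\forall}A,X\vdash Y$ infer $x\!:\!\Box A,X\vdash Y$ ($a$ fresh); $\Box_R^{\mathsf{m}}$: from $a\in N(x),y\in a,X\vdash Y,x\!:\!\Box B,y\!:\!B$ infer $a\in N(x),X\vdash Y,x\!:\!\Box B$ ($y$ fresh).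
   Formalization: In LbNS, propositional rules and axioms act only at labels of the end sequent or at y with some xNy among the relation terms (otherwise ⊢ x:□⊥ is derivable in LbNS_E but not in G3E), and the left box rule consumes its term xN_e(y1,y2). *)

theory Defs
  imports "HOL-Library.Multiset"
begin

section \<open>Formulae and labelled formulae\<close>

datatype fm =
    Atom nat
  | Bot
  | And fm fm
  | Or fm fm
  | Imp fm fm
  | Box fm

text \<open>
  One countably infinite supply of labels serves both as the state variables of the labelled
  nested systems and as the world labels of the neighbourhood systems, so that labelled formulae
  can be shared between the two kinds of calculi.  The pair \<open>(x, A)\<close> is the labelled
  formula written \<open>x : A\<close>.
\<close>

type_synonym label = nat
type_synonym lfm = "label \<times> fm"

datatype logic = LogicE | LogicM


section \<open>The systems LbNS\<close>

datatype rel =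
    Nb label label          (* x N y *)
  | NbE label label label   (* x N_e (y1, y2) *)

primrec rel_labels :: "rel \<Rightarrow> label set" where
  "rel_labels (Nb x y) = {x, y}"
| "rel_labels (NbE x y1 y2) = {x, y1, y2}"

definition lfm_labels :: "lfm multiset \<Rightarrow> label set" where
  "lfm_labels X = fst ` set_mset X"

text \<open>
  The term \<open>NbE x y1 y2\<close> denotes an unfinished pair of components: it has to be
  resolved by the left box rule, each premise of which turns exactly one of the two variables
  into a genuine component, by putting \<open>Nb x y1\<close> or \<open>Nb x y2\<close> in its place.
  The propositional rules and axioms act inside one component of the nested sequent, so their
  label must be a root of the end sequent or must occur as a second argument of \<open>Nb\<close>.
  This restriction cannot be dropped.  If axioms could be used inside unfinished or discarded
  components, then the premise of the right box rule for \<open>x : Box Bot\<close> would be an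
  instance of the axiom for \<open>Bot\<close> (at \<open>y2\<close>), and the additional rule of the
  monotone system would prove every \<open>x : Box B\<close>.

  The roots are a fixed parameter of a derivation and count as used labels for the purpose of
  freshness.
\<close>

definition component :: "label set \<Rightarrow> rel set \<Rightarrow> label \<Rightarrow> bool" where
  "component R N y \<longleftrightarrow> y \<in> R \<or> (\<exists>x. Nb x y \<in> N)"

definition lbns_used :: "label set \<Rightarrow> rel set \<Rightarrow> lfm multiset \<Rightarrow> lfm multiset \<Rightarrow> label set" where
  "lbns_used R N X Y = R \<union> \<Union> (rel_labels ` N) \<union> lfm_labels X \<union> lfm_labels Y"

text \<open>
  In the left box rule the comma is disjoint union: the principal relation term is consumed.
\<close>

inductive lbns :: "logic \<Rightarrow> label set \<Rightarrow> rel set \<Rightarrow> lfm multiset \<Rightarrow> lfm multiset \<Rightarrow> bool"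
  for L :: logic and R :: "label set"
where
  lbns_init:
    "component R N x \<Longrightarrow>
     lbns L R N (add_mset (x, Atom p) X) (add_mset (x, Atom p) Y)"
| lbns_BotL:
    "component R N x \<Longrightarrow> lbns L R N (add_mset (x, Bot) X) Y"
| lbns_AndL:
    "component R N x \<Longrightarrow>
     lbns L R N (add_mset (x, A) (add_mset (x, B) X)) Y \<Longrightarrow>
     lbns L R N (add_mset (x, And A B) X) Y"
| lbns_AndR:
    "component R N x \<Longrightarrow>
     lbns L R N X (add_mset (x, A) Y) \<Longrightarrow>
     lbns L R N X (add_mset (x, B) Y) \<Longrightarrow>
     lbns L R N X (add_mset (x, And A B) Y)"
| lbns_OrL:
    "component R N x \<Longrightarrow>
     lbns L R N (add_mset (x, A) X) Y \<Longrightarrow>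
     lbns L R N (add_mset (x, B) X) Y \<Longrightarrow>
     lbns L R N (add_mset (x, Or A B) X) Y"
| lbns_OrR:
    "component R N x \<Longrightarrow>
     lbns L R N X (add_mset (x, A) (add_mset (x, B) Y)) \<Longrightarrow>
     lbns L R N X (add_mset (x, Or A B) Y)"
| lbns_ImpL:
    "component R N x \<Longrightarrow>
     lbns L R N X (add_mset (x, A) Y) \<Longrightarrow>
     lbns L R N (add_mset (x, B) X) Y \<Longrightarrow>
     lbns L R N (add_mset (x, Imp A B) X) Y"
| lbns_ImpR:
    "component R N x \<Longrightarrow>
     lbns L R N (add_mset (x, A) X) (add_mset (x, B) Y) \<Longrightarrow>
     lbns L R N X (add_mset (x, Imp A B) Y)"
| lbns_BoxR:
    "y1 \<noteq> y2 \<Longrightarrow>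
     y1 \<notin> lbns_used R N X (add_mset (x, Box B) Y) \<Longrightarrow>
     y2 \<notin> lbns_used R N X (add_mset (x, Box B) Y) \<Longrightarrow>
     lbns L R (insert (NbE x y1 y2) N) (add_mset (y2, B) X) (add_mset (y1, B) Y) \<Longrightarrow>
     lbns L R N X (add_mset (x, Box B) Y)"
| lbns_BoxL:
    "NbE x y1 y2 \<notin> N \<Longrightarrow>
     lbns L R (insert (Nb x y1) N) (add_mset (y1, A) X) Y \<Longrightarrow>
     lbns L R (insert (Nb x y2) N) X (add_mset (y2, A) Y) \<Longrightarrow>
     lbns L R (insert (NbE x y1 y2) N) (add_mset (x, Box A) X) Y"
| lbns_M:
    "L = LogicM \<Longrightarrow>
     lbns L R (insert (NbE x y1 y2) N) (add_mset (y2, Bot) X) Y \<Longrightarrow>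
     lbns L R (insert (NbE x y1 y2) N) X Y"

text \<open>
  Without relation terms, every label of the end sequent is a root.
\<close>

definition lbns_derivable :: "logic \<Rightarrow> lfm multiset \<Rightarrow> lfm multiset \<Rightarrow> bool" where
  "lbns_derivable L X Y \<longleftrightarrow> lbns L (lfm_labels X \<union> lfm_labels Y) {} X Y"


section \<open>The systems G3\<close>

type_synonym nlabel = nat

datatype item =
    Lab label fm            (* x : A *)
  | NbIn nlabel label       (* a \<in> N(x) *)
  | Mem label nlabel        (* x \<in> a *)
  | ForcesAll nlabel fm     (* all worlds of a force A *)
  | Covers fm nlabel        (* all worlds forcing A are in a *)

primrec item_labels :: "item \<Rightarrow> label set" where
  "item_labels (Lab x A) = {x}"
| "item_labels (NbIn a x) = {x}"
| "item_labels (Mem x a) = {x}"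
| "item_labels (ForcesAll a A) = {}"
| "item_labels (Covers A a) = {}"

primrec item_nlabels :: "item \<Rightarrow> nlabel set" where
  "item_nlabels (Lab x A) = {}"
| "item_nlabels (NbIn a x) = {a}"
| "item_nlabels (Mem x a) = {a}"
| "item_nlabels (ForcesAll a A) = {a}"
| "item_nlabels (Covers A a) = {a}"

definition g3_labels :: "item multiset \<Rightarrow> item multiset \<Rightarrow> label set" where
  "g3_labels X Y = \<Union> (item_labels ` (set_mset X \<union> set_mset Y))"

definition g3_nlabels :: "item multiset \<Rightarrow> item multiset \<Rightarrow> nlabel set" where
  "g3_nlabels X Y = \<Union> (item_nlabels ` (set_mset X \<union> set_mset Y))"

inductive g3 :: "logic \<Rightarrow> item multiset \<Rightarrow> item multiset \<Rightarrow> bool"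
  for L :: logic
where
  g3_init:
    "g3 L (add_mset (Lab x (Atom p)) X) (add_mset (Lab x (Atom p)) Y)"
| g3_BotL:
    "g3 L (add_mset (Lab x Bot) X) Y"
| g3_AndL:
    "g3 L (add_mset (Lab x A) (add_mset (Lab x B) X)) Y \<Longrightarrow>
     g3 L (add_mset (Lab x (And A B)) X) Y"
| g3_AndR:
    "g3 L X (add_mset (Lab x A) Y) \<Longrightarrow>
     g3 L X (add_mset (Lab x B) Y) \<Longrightarrow>
     g3 L X (add_mset (Lab x (And A B)) Y)"
| g3_OrL:
    "g3 L (add_mset (Lab x A) X) Y \<Longrightarrow>
     g3 L (add_mset (Lab x B) X) Y \<Longrightarrow>
     g3 L (add_mset (Lab x (Or A B)) X) Y"
| g3_OrR:
    "g3 L X (add_mset (Lab x A) (add_mset (Lab x B) Y)) \<Longrightarrow>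
     g3 L X (add_mset (Lab x (Or A B)) Y)"
| g3_ImpL:
    "g3 L X (add_mset (Lab x A) Y) \<Longrightarrow>
     g3 L (add_mset (Lab x B) X) Y \<Longrightarrow>
     g3 L (add_mset (Lab x (Imp A B)) X) Y"
| g3_ImpR:
    "g3 L (add_mset (Lab x A) X) (add_mset (Lab x B) Y) \<Longrightarrow>
     g3 L X (add_mset (Lab x (Imp A B)) Y)"
| g3_init_Mem:
    "g3 L (add_mset (Mem x a) X) (add_mset (Mem x a) Y)"
| g3_ForcesAll:
    "g3 L (add_mset (Mem x a) (add_mset (Lab x A) (add_mset (ForcesAll a A) X))) Y \<Longrightarrow>
     g3 L (add_mset (Mem x a) (add_mset (ForcesAll a A) X)) Y"
| g3_Covers:
    "L = LogicE \<Longrightarrow>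
     g3 L (add_mset (Covers A a) X) (add_mset (Lab z A) Y) \<Longrightarrow>
     g3 L (add_mset (Mem z a) (add_mset (Covers A a) X)) Y \<Longrightarrow>
     g3 L (add_mset (Covers A a) X) Y"
| g3_BoxL_E:
    "L = LogicE \<Longrightarrow>
     a \<notin> g3_nlabels (add_mset (Lab x (Box A)) X) Y \<Longrightarrow>
     g3 L (add_mset (NbIn a x) (add_mset (ForcesAll a A) (add_mset (Covers A a) X))) Y \<Longrightarrow>
     g3 L (add_mset (Lab x (Box A)) X) Y"
| g3_BoxR_E:
    "L = LogicE \<Longrightarrow>
     y \<notin> g3_labels (add_mset (NbIn a x) X) (add_mset (Lab x (Box B)) Y) \<Longrightarrow>
     z \<notin> g3_labels (add_mset (NbIn a x) X) (add_mset (Lab x (Box B)) Y) \<Longrightarrow>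
     g3 L (add_mset (Mem z a) (add_mset (NbIn a x) X))
          (add_mset (Lab z B) (add_mset (Lab x (Box B)) Y)) \<Longrightarrow>
     g3 L (add_mset (Lab y B) (add_mset (NbIn a x) X))
          (add_mset (Mem y a) (add_mset (Lab x (Box B)) Y)) \<Longrightarrow>
     g3 L (add_mset (NbIn a x) X) (add_mset (Lab x (Box B)) Y)"
| g3_BoxL_M:
    "L = LogicM \<Longrightarrow>
     a \<notin> g3_nlabels (add_mset (Lab x (Box A)) X) Y \<Longrightarrow>
     g3 L (add_mset (NbIn a x) (add_mset (ForcesAll a A) X)) Y \<Longrightarrow>
     g3 L (add_mset (Lab x (Box A)) X) Y"
| g3_BoxR_M:
    "L = LogicM \<Longrightarrow>
     y \<notin> g3_labels (add_mset (NbIn a x) X) (add_mset (Lab x (Box B)) Y) \<Longrightarrow>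
     g3 L (add_mset (NbIn a x) (add_mset (Mem y a) X))
          (add_mset (Lab y B) (add_mset (Lab x (Box B)) Y)) \<Longrightarrow>
     g3 L (add_mset (NbIn a x) X) (add_mset (Lab x (Box B)) Y)"

definition items :: "lfm multiset \<Rightarrow> item multiset" where
  "items X = image_mset (\<lambda>(x, A). Lab x A) X"

definition g3_derivable :: "logic \<Rightarrow> lfm multiset \<Rightarrow> lfm multiset \<Rightarrow> bool" where
  "g3_derivable L X Y \<longleftrightarrow> g3 L (items X) (items Y)"

end

theory Submission
  imports Defs
begin

text \<open>
  Both labelled calculi are compared with an unlabelled cut-free sequent calculus \<open>sq\<close>:
  a labelled sequent is derivable iff at one of its labels the local sequent is derivable.

  From \<open>sq\<close> to the labelled calculi one simulates rule by rule. Conversely, every labelled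
  sequent is read as a family of local sequents by restoring the boxed formulae that have been
  consumed: in LbNS a term \<open>x N_e (y1, y2)\<close> introduced for \<open>Box B\<close> counts as
  \<open>x : Box B\<close> on the right; in G3 a neighbourhood label \<open>a\<close> introduced for \<open>Box A\<close>
  stands for the extension of \<open>A\<close>, so \<open>a \<in> N(x)\<close> counts as \<open>x : Box A\<close> and \<open>z \<in> a\<close>
  as \<open>z : A\<close>. The rule for \<open>\<lhd>\<close> then becomes a cut.

  Weakening, contraction and cut for the local sequents come from a characterisation of
  \<open>sq\<close> by pairs \<open>(P, Q)\<close> of sets of atoms and boxed formulae: a sequent is derivable iff
  every pair making its left side true and its right side false contains a clash.
\<close>

section \<open>The unlabelled calculus\<close>

text \<open>The arbitrary contexts in \<open>sq_Box\<close> build weakening into the one rule whose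
  premises drop the context. The second premise, demanded for E only, turns monotonicity into
  congruence.\<close>

inductive sq :: "logic \<Rightarrow> fm multiset \<Rightarrow> fm multiset \<Rightarrow> bool" for L :: logic where
  sq_init: "sq L (add_mset (Atom p) \<Gamma>) (add_mset (Atom p) \<Delta>)"
| sq_BotL: "sq L (add_mset Bot \<Gamma>) \<Delta>"
| sq_AndL: "sq L (add_mset A (add_mset B \<Gamma>)) \<Delta> \<Longrightarrow> sq L (add_mset (And A B) \<Gamma>) \<Delta>"
| sq_AndR: "sq L \<Gamma> (add_mset A \<Delta>) \<Longrightarrow> sq L \<Gamma> (add_mset B \<Delta>) \<Longrightarrow>
    sq L \<Gamma> (add_mset (And A B) \<Delta>)"
| sq_OrL: "sq L (add_mset A \<Gamma>) \<Delta> \<Longrightarrow> sq L (add_mset B \<Gamma>) \<Delta> \<Longrightarrow>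
    sq L (add_mset (Or A B) \<Gamma>) \<Delta>"
| sq_OrR: "sq L \<Gamma> (add_mset A (add_mset B \<Delta>)) \<Longrightarrow> sq L \<Gamma> (add_mset (Or A B) \<Delta>)"
| sq_ImpL: "sq L \<Gamma> (add_mset A \<Delta>) \<Longrightarrow> sq L (add_mset B \<Gamma>) \<Delta> \<Longrightarrow>
    sq L (add_mset (Imp A B) \<Gamma>) \<Delta>"
| sq_ImpR: "sq L (add_mset A \<Gamma>) (add_mset B \<Delta>) \<Longrightarrow> sq L \<Gamma> (add_mset (Imp A B) \<Delta>)"
| sq_Box: "sq L {#A#} {#B#} \<Longrightarrow> (L = LogicE \<Longrightarrow> sq L {#B#} {#A#}) \<Longrightarrow>
    sq L (add_mset (Box A) \<Gamma>) (add_mset (Box B) \<Delta>)"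

section \<open>Pairs of sets as a semantics of local sequents\<close>

definition linked :: "logic \<Rightarrow> fm \<Rightarrow> fm \<Rightarrow> bool" where
  "linked L A B \<longleftrightarrow> sq L {#A#} {#B#} \<and> (L = LogicE \<longrightarrow> sq L {#B#} {#A#})"

text \<open>Only the outer propositional layer is treated semantically: boxed formulae behave like
  atoms, and derivability between their bodies decides which of them may not be true and false
  together.\<close>

definition clash :: "logic \<Rightarrow> fm set \<Rightarrow> fm set \<Rightarrow> bool" where
  "clash L P Q \<longleftrightarrow> (\<exists>p. Atom p \<in> P \<and> Atom p \<in> Q) \<or>
    (\<exists>A B. Box A \<in> P \<and> Box B \<in> Q \<and> linked L A B)"

text \<open>Truth and falsity are defined independently, so a formula may be undecided; being both
  forces a clash (\<open>cons_refl\<close>). The clauses of \<open>tt\<close> mirror the left rules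
  and those of \<open>ff\<close> the right rules, and both are monotone in the pair.\<close>

fun tt :: "fm set \<Rightarrow> fm set \<Rightarrow> fm \<Rightarrow> bool" and ff :: "fm set \<Rightarrow> fm set \<Rightarrow> fm \<Rightarrow> bool" where
  "tt P Q (Atom p) \<longleftrightarrow> Atom p \<in> P"
| "tt P Q Bot \<longleftrightarrow> False"
| "tt P Q (And A B) \<longleftrightarrow> tt P Q A \<and> tt P Q B"
| "tt P Q (Or A B) \<longleftrightarrow> tt P Q A \<or> tt P Q B"
| "tt P Q (Imp A B) \<longleftrightarrow> ff P Q A \<or> tt P Q B"
| "tt P Q (Box A) \<longleftrightarrow> Box A \<in> P"
| "ff P Q (Atom p) \<longleftrightarrow> Atom p \<in> Q"
| "ff P Q Bot \<longleftrightarrow> True"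
| "ff P Q (And A B) \<longleftrightarrow> ff P Q A \<or> ff P Q B"
| "ff P Q (Or A B) \<longleftrightarrow> ff P Q A \<and> ff P Q B"
| "ff P Q (Imp A B) \<longleftrightarrow> tt P Q A \<and> ff P Q B"
| "ff P Q (Box A) \<longleftrightarrow> Box A \<in> Q"

lemma tt_ff_mono:
  assumes "P \<subseteq> P'" "Q \<subseteq> Q'"
  shows "(tt P Q A \<longrightarrow> tt P' Q' A) \<and> (ff P Q A \<longrightarrow> ff P' Q' A)"
  using assms by (induction A) auto

definition cons :: "logic \<Rightarrow> fm set \<Rightarrow> fm set \<Rightarrow> bool" where
  "cons L \<Gamma> \<Delta> \<longleftrightarrow>
    (\<forall>P Q. (\<forall>A\<in>\<Gamma>. tt P Q A) \<longrightarrow> (\<forall>B\<in>\<Delta>. ff P Q B) \<longrightarrow> clash L P Q)"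

lemma cons_mono: "cons L \<Gamma> \<Delta> \<Longrightarrow> \<Gamma> \<subseteq> \<Gamma>' \<Longrightarrow> \<Delta> \<subseteq> \<Delta>' \<Longrightarrow> cons L \<Gamma>' \<Delta>'"
  unfolding cons_def by blast

lemma not_cons_empty: "\<not> cons L {} {}"
  by (auto simp: cons_def clash_def)

text \<open>Root-first proof search on the total size. The propositional rules are invertible for
  this semantics, so \<open>cons\<close> passes from a sequent to the premises of any rule that
  decomposes it; once nothing can be decomposed, a clash is exactly an instance of
  \<open>sq_init\<close> or \<open>sq_Box\<close>.\<close>

lemma cons_imp_sq: "cons L (set_mset \<Gamma>) (set_mset \<Delta>) \<Longrightarrow> sq L \<Gamma> \<Delta>"
proof (induction "sum_mset (image_mset size \<Gamma>) + sum_mset (image_mset size \<Delta>)"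
    arbitrary: \<Gamma> \<Delta> rule: less_induct)
  case less
  \<comment> \<open>For each premise it remains to check that a pair suited to it is also suited to
    the conclusion.\<close>
  have IH: "sq L \<Gamma>' \<Delta>'"
    if "sum_mset (image_mset size \<Gamma>') + sum_mset (image_mset size \<Delta>')
          < sum_mset (image_mset size \<Gamma>) + sum_mset (image_mset size \<Delta>)"
      and "\<And>P Q. \<forall>A\<in>#\<Gamma>'. tt P Q A \<Longrightarrow> \<forall>B\<in>#\<Delta>'. ff P Q B \<Longrightarrow>
            (\<forall>A\<in>#\<Gamma>. tt P Q A) \<and> (\<forall>B\<in>#\<Delta>. ff P Q B)" for \<Gamma>' \<Delta>'
    using less.hyps[OF that(1)] less.prems that(2) unfolding cons_def by blast
  consider (andl) A B where "And A B \<in># \<Gamma>" | (orl) A B where "Or A B \<in># \<Gamma>"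
    | (impl) A B where "Imp A B \<in># \<Gamma>" | (botl) "Bot \<in># \<Gamma>"
    | (andr) A B where "And A B \<in># \<Delta>" | (orr) A B where "Or A B \<in># \<Delta>"
    | (impr) A B where "Imp A B \<in># \<Delta>"
    | (lits) "\<forall>A\<in>#\<Gamma>. tt (set_mset \<Gamma>) (set_mset \<Delta>) A" "\<forall>B\<in>#\<Delta>. ff (set_mset \<Gamma>) (set_mset \<Delta>) B"
  proof -
    have "tt (set_mset \<Gamma>) (set_mset \<Delta>) A"
      if "A \<in># \<Gamma>" "\<And>C D. And C D \<notin># \<Gamma>" "\<And>C D. Or C D \<notin># \<Gamma>" "\<And>C D. Imp C D \<notin># \<Gamma>"
        "Bot \<notin># \<Gamma>" for A
      using that by (cases A) auto
    moreover have "ff (set_mset \<Gamma>) (set_mset \<Delta>) A"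
      if "A \<in># \<Delta>" "\<And>C D. And C D \<notin># \<Delta>" "\<And>C D. Or C D \<notin># \<Delta>" "\<And>C D. Imp C D \<notin># \<Delta>" for A
      using that by (cases A) auto
    ultimately show thesis using that by blast
  qed
  then show ?case
  proof cases
    case andl
    then obtain \<Gamma>' where eq: "\<Gamma> = add_mset (And A B) \<Gamma>'" by (metis mset_add)
    show ?thesis unfolding eq by (rule sq_AndL; rule IH) (auto simp: eq)
  next
    case orl
    then obtain \<Gamma>' where eq: "\<Gamma> = add_mset (Or A B) \<Gamma>'" by (metis mset_add)
    show ?thesis unfolding eq by (rule sq_OrL; rule IH) (auto simp: eq)
  next
    case impl
    then obtain \<Gamma>' where eq: "\<Gamma> = add_mset (Imp A B) \<Gamma>'" by (metis mset_add)
    show ?thesis unfolding eq by (rule sq_ImpL; rule IH) (auto simp: eq)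
  next
    case botl
    then show ?thesis by (metis mset_add sq_BotL)
  next
    case andr
    then obtain \<Delta>' where eq: "\<Delta> = add_mset (And A B) \<Delta>'" by (metis mset_add)
    show ?thesis unfolding eq by (rule sq_AndR; rule IH) (auto simp: eq)
  next
    case orr
    then obtain \<Delta>' where eq: "\<Delta> = add_mset (Or A B) \<Delta>'" by (metis mset_add)
    show ?thesis unfolding eq by (rule sq_OrR; rule IH) (auto simp: eq)
  next
    case impr
    then obtain \<Delta>' where eq: "\<Delta> = add_mset (Imp A B) \<Delta>'" by (metis mset_add)
    show ?thesis unfolding eq by (rule sq_ImpR; rule IH) (auto simp: eq)
  next
    case lits
    \<comment> \<open>The two sides of the sequent themselves serve as the pair. A remaining
      \<open>Bot\<close> on the right does no harm, as it is always false.\<close>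
    then have "clash L (set_mset \<Gamma>) (set_mset \<Delta>)"
      using less.prems unfolding cons_def by blast
    then consider p where "Atom p \<in># \<Gamma>" "Atom p \<in># \<Delta>"
      | A B where "Box A \<in># \<Gamma>" "Box B \<in># \<Delta>" "linked L A B"
      unfolding clash_def by blast
    then show ?thesis
    proof cases
      case 1
      then show ?thesis by (metis mset_add sq_init)
    next
      case 2
      then obtain \<Gamma>' \<Delta>' where "\<Gamma> = add_mset (Box A) \<Gamma>'" "\<Delta> = add_mset (Box B) \<Delta>'"
        by (metis mset_add)
      with 2 show ?thesis by (auto simp: linked_def intro: sq_Box)
    qed
  qed
qed

lemma sq_imp_cons: "sq L \<Gamma> \<Delta> \<Longrightarrow> cons L (set_mset \<Gamma>) (set_mset \<Delta>)"
proof (induction rule: sq.induct)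
  case (sq_Box A B \<Gamma> \<Delta>)
  then show ?case by (auto simp: cons_def clash_def linked_def)
next
  case (sq_init p \<Gamma> \<Delta>)
  then show ?case by (auto simp: cons_def clash_def)
qed (auto simp: cons_def)

text \<open>This removes the reference to \<open>sq\<close> hidden in \<open>clash\<close>, so that
  modal reasoning can stay inside \<open>cons\<close>, where weakening and contraction are
  free.\<close>

lemma linked_iff_cons:
  "linked L A B \<longleftrightarrow> cons L {A} {B} \<and> (L = LogicE \<longrightarrow> cons L {B} {A})"
  unfolding linked_def
  using cons_imp_sq[of L "{#A#}" "{#B#}"] cons_imp_sq[of L "{#B#}" "{#A#}"]
    sq_imp_cons[of L "{#A#}" "{#B#}"] sq_imp_cons[of L "{#B#}" "{#A#}"]
  by auto

lemma cons_Box: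
  assumes "Box A \<in> \<Gamma>" "Box B \<in> \<Delta>" "cons L {A} {B}" "L = LogicE \<Longrightarrow> cons L {B} {A}"
  shows "cons L \<Gamma> \<Delta>"
proof -
  have "linked L A B"
    using assms(3,4) by (simp add: linked_iff_cons)
  then show ?thesis
    using assms(1,2) unfolding cons_def clash_def by fastforce
qed

section \<open>Identity and cut\<close>

lemma cons_refl: "cons L {A} {A}"
proof (induction A)
  case (Box A)
  then show ?case by (auto intro: cons_Box)
qed (auto simp: cons_def clash_def)

lemma cons_common:
  assumes "A \<in> \<Gamma>" "A \<in> \<Delta>"
  shows "cons L \<Gamma> \<Delta>"
  using cons_mono[OF cons_refl] assms by blast

text \<open>
  The semantic content of cut: \<open>Box C\<close> is made true when some \<open>Box A \<in> P\<close> forces it, and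
  false otherwise; that no clash arises is transitivity of \<^const>\<open>linked\<close> through \<open>C\<close>,
  i.e. the induction hypothesis.
\<close>

lemma decide_formula:
  assumes "\<not> clash L P Q"
  shows "\<exists>P' Q'. P \<subseteq> P' \<and> Q \<subseteq> Q' \<and> \<not> clash L P' Q' \<and> (tt P' Q' A \<or> ff P' Q' A)"
  using assms
proof (induction A arbitrary: P Q)
  case (Atom p)
  show ?case
  proof (cases "Atom p \<in> Q")
    case True
    then show ?thesis using Atom by auto
  next
    case False
    then show ?thesis using Atom
      by (intro exI[of _ "insert (Atom p) P"] exI[of _ Q]) (auto simp: clash_def)
  qed
next
  case (Box C)
  have trans: "cons L {A} {D}" if "cons L {A} {C}" "cons L {C} {D}" for A D
    unfolding cons_def
  proof (intro allI impI, rule ccontr)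
    fix P Q assume *: "\<forall>A\<in>{A}. tt P Q A" "\<forall>B\<in>{D}. ff P Q B" "\<not> clash L P Q"
    obtain P' Q' where "P \<subseteq> P'" "Q \<subseteq> Q'" "\<not> clash L P' Q'" "tt P' Q' C \<or> ff P' Q' C"
      using Box.IH[OF *(3)] by blast
    then show False
      using that * tt_ff_mono[of P P' Q Q'] unfolding cons_def by blast
  qed
  show ?case
  proof (cases "\<exists>A. Box A \<in> P \<and> linked L A C")
    case True
    then obtain A where A: "Box A \<in> P" "linked L A C" by blast
    have "\<not> linked L C D" if "Box D \<in> Q" for D
    proof
      assume "linked L C D"
      then have "linked L A D" using A(2) trans unfolding linked_iff_cons by blast
      then show False using Box.prems A(1) that by (auto simp: clash_def)
    qed
    then have "\<not> clash L (insert (Box C) P) Q"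
      using Box.prems by (auto simp: clash_def)
    then show ?thesis
      by (intro exI[of _ "insert (Box C) P"] exI[of _ Q]) auto
  next
    case False
    then have "\<not> clash L P (insert (Box C) Q)"
      using Box.prems by (auto simp: clash_def)
    then show ?thesis
      by (intro exI[of _ P] exI[of _ "insert (Box C) Q"]) auto
  qed
next
  case Bot
  then show ?case by auto
next
  case (And A B)
  from And.IH(1)[OF And.prems] obtain P1 Q1 where
    1: "P \<subseteq> P1" "Q \<subseteq> Q1" "\<not> clash L P1 Q1" "tt P1 Q1 A \<or> ff P1 Q1 A" by blast
  \<comment> \<open>The second formula is decided over the pair that already decides the first; by
    monotonicity the first decision survives.\<close>
  from And.IH(2)[OF 1(3)] obtain P2 Q2 where
    2: "P1 \<subseteq> P2" "Q1 \<subseteq> Q2" "\<not> clash L P2 Q2" "tt P2 Q2 B \<or> ff P2 Q2 B" by blast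
  show ?case
    using 1 2 tt_ff_mono[OF 2(1,2), of A] by (intro exI[of _ P2] exI[of _ Q2]) auto
next
  case (Or A B)
  from Or.IH(1)[OF Or.prems] obtain P1 Q1 where
    1: "P \<subseteq> P1" "Q \<subseteq> Q1" "\<not> clash L P1 Q1" "tt P1 Q1 A \<or> ff P1 Q1 A" by blast
  from Or.IH(2)[OF 1(3)] obtain P2 Q2 where
    2: "P1 \<subseteq> P2" "Q1 \<subseteq> Q2" "\<not> clash L P2 Q2" "tt P2 Q2 B \<or> ff P2 Q2 B" by blast
  show ?case
    using 1 2 tt_ff_mono[OF 2(1,2), of A] by (intro exI[of _ P2] exI[of _ Q2]) auto
next
  case (Imp A B)
  from Imp.IH(1)[OF Imp.prems] obtain P1 Q1 where
    1: "P \<subseteq> P1" "Q \<subseteq> Q1" "\<not> clash L P1 Q1" "tt P1 Q1 A \<or> ff P1 Q1 A" by blast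
  from Imp.IH(2)[OF 1(3)] obtain P2 Q2 where
    2: "P1 \<subseteq> P2" "Q1 \<subseteq> Q2" "\<not> clash L P2 Q2" "tt P2 Q2 B \<or> ff P2 Q2 B" by blast
  show ?case
    using 1 2 tt_ff_mono[OF 2(1,2), of A] by (intro exI[of _ P2] exI[of _ Q2]) auto
qed

text \<open>A clash-free pair refuting the conclusion extends to one that decides the cut formula,
  and by monotonicity the extension refutes one of the premises.\<close>

lemma cons_cut:
  assumes "cons L \<Gamma> (insert A \<Delta>)" "cons L (insert A \<Gamma>) \<Delta>"
  shows "cons L \<Gamma> \<Delta>"
  unfolding cons_def
proof (intro allI impI, rule ccontr)
  fix P Q assume *: "\<forall>A\<in>\<Gamma>. tt P Q A" "\<forall>B\<in>\<Delta>. ff P Q B" "\<not> clash L P Q"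
  obtain P' Q' where "P \<subseteq> P'" "Q \<subseteq> Q'" "\<not> clash L P' Q'" "tt P' Q' A \<or> ff P' Q' A"
    using decide_formula[OF *(3)] by blast
  then show False
    using assms * tt_ff_mono[of P P' Q Q'] unfolding cons_def by blast
qed

section \<open>Propositional rules for \<open>cons\<close>\<close>

lemma cons_And_right:
  "cons L \<Gamma> (insert A \<Delta>) \<Longrightarrow> cons L \<Gamma> (insert B \<Delta>) \<Longrightarrow> cons L \<Gamma> (insert (And A B) \<Delta>)"
  by (auto simp: cons_def)

lemma cons_Or_left:
  "cons L (insert A \<Gamma>) \<Delta> \<Longrightarrow> cons L (insert B \<Gamma>) \<Delta> \<Longrightarrow> cons L (insert (Or A B) \<Gamma>) \<Delta>"
  by (auto simp: cons_def)

lemma cons_Imp_left: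
  "cons L \<Gamma> (insert A \<Delta>) \<Longrightarrow> cons L (insert B \<Gamma>) \<Delta> \<Longrightarrow> cons L (insert (Imp A B) \<Gamma>) \<Delta>"
  by (auto simp: cons_def)

lemma cons_And_left: "cons L (insert A (insert B \<Gamma>)) \<Delta> \<Longrightarrow> cons L (insert (And A B) \<Gamma>) \<Delta>"
  by (auto simp: cons_def)

lemma cons_Or_right: "cons L \<Gamma> (insert A (insert B \<Delta>)) \<Longrightarrow> cons L \<Gamma> (insert (Or A B) \<Delta>)"
  by (auto simp: cons_def)

lemma cons_Imp_right: "cons L (insert A \<Gamma>) (insert B \<Delta>) \<Longrightarrow> cons L \<Gamma> (insert (Imp A B) \<Delta>)"
  by (auto simp: cons_def)

lemma cons_Bot_left: "Bot \<in> \<Gamma> \<Longrightarrow> cons L \<Gamma> \<Delta>"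
  by (auto simp: cons_def)

text \<open>Serves the rules acting at a single label \<open>x\<close>. A good label other than
  \<open>x\<close> has the same local sequent in premise and conclusion, so the local rule is
  invoked only if both premises point at \<open>x\<close>. One-premise rules use it with the premise
  taken twice.\<close>

lemma ex_merge:
  assumes "\<exists>c. P1 c" "\<exists>c. P2 c" "\<And>c. c \<noteq> x \<Longrightarrow> P1 c \<Longrightarrow> P c" "\<And>c. c \<noteq> x \<Longrightarrow> P2 c \<Longrightarrow> P c"
    and "P1 x \<Longrightarrow> P2 x \<Longrightarrow> P x"
  shows "\<exists>c. P c"
proof -
  obtain c1 c2 where "P1 c1" "P2 c2" using assms(1,2) by blast
  then show ?thesis using assms(3)[of c1] assms(4)[of c2] assms(5) by (cases "c1 = x"; cases "c2 = x") auto
qed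


section \<open>Simulation in the labelled calculi\<close>

abbreviation at :: "label \<Rightarrow> fm multiset \<Rightarrow> lfm multiset" where
  "at x \<Gamma> \<equiv> image_mset (Pair x) \<Gamma>"

lemma finite_lbns_used:
  assumes "finite R" "finite N"
  shows "finite (lbns_used R N X Y)"
proof -
  have "finite (rel_labels r)" for r by (cases r) auto
  then show ?thesis using assms by (auto simp: lbns_used_def lfm_labels_def)
qed

text \<open>The contexts \<open>X\<close>, \<open>Y\<close> and the terms \<open>N\<close> are
  arbitrary so that the induction hypothesis applies at a new component while the old formulae
  remain. A box step is \<open>lbns_BoxR\<close> followed by an immediate resolution of the new pair
  with \<open>Box A\<close>.\<close>

lemma sq_imp_lbns:
  assumes "sq L \<Gamma> \<Delta>" "finite R" "finite N" "component R N x"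
  shows "lbns L R N (at x \<Gamma> + X) (at x \<Delta> + Y)"
  using assms
proof (induction arbitrary: N x X Y rule: sq.induct)
  case (sq_Box A B \<Gamma> \<Delta>)
  let ?X = "add_mset (x, Box A) (at x \<Gamma> + X)" and ?Y = "at x \<Delta> + Y"
  let ?U = "lbns_used R N ?X (add_mset (x, Box B) ?Y)"
  have fin: "finite ?U" using sq_Box.prems by (intro finite_lbns_used)
  obtain y1 where y1: "y1 \<notin> ?U" using ex_new_if_finite[OF infinite_UNIV_nat fin] by blast
  obtain y2 where "y2 \<notin> insert y1 ?U"
    using ex_new_if_finite[OF infinite_UNIV_nat, of "insert y1 ?U"] fin by auto
  then have y2: "y2 \<notin> ?U" "y1 \<noteq> y2" by auto
  \<comment> \<open>The left box rule consumes its principal term, so the pair must not already lie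
    in \<open>N\<close>.\<close>
  have new: "NbE x y1 y2 \<notin> N" using y1 by (force simp: lbns_used_def)
  have comp: "component R (insert (Nb x y) N) y" for y by (auto simp: component_def)
  have left: "lbns L R (insert (Nb x y1) N) (add_mset (y1, A) X') (add_mset (y1, B) ?Y)" for X'
    using sq_Box.IH(1)[OF sq_Box.prems(1) _ comp, of y1 X' ?Y] sq_Box.prems(2) by simp
  have "lbns L R (insert (NbE x y1 y2) N) (add_mset (y2, B) ?X) (add_mset (y1, B) ?Y)"
  proof (cases L)
    case LogicE
    have "lbns L R (insert (Nb x y2) N) (add_mset (y2, B) (at x \<Gamma> + X))
        (add_mset (y2, A) (add_mset (y1, B) ?Y))"
      using sq_Box.IH(2)[OF LogicE sq_Box.prems(1) _ comp, of y2] sq_Box.prems(2) by simp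
    from lbns_BoxL[OF new left this] show ?thesis by (simp add: add_mset_commute)
  next
    case LogicM
    \<comment> \<open>In M the second branch needs no converse derivation: \<open>lbns_M\<close>
      supplies \<open>Bot\<close> at \<open>y2\<close>, and once \<open>y2\<close> has become a
      component the axiom closes the branch.\<close>
    have "lbns L R (insert (Nb x y2) N) (add_mset (y2, Bot) (add_mset (y2, B) (at x \<Gamma> + X)))
        (add_mset (y2, A) (add_mset (y1, B) ?Y))"
      by (rule lbns_BotL[OF comp])
    from lbns_BoxL[OF new left this]
    have "lbns L R (insert (NbE x y1 y2) N) (add_mset (y2, Bot) (add_mset (y2, B) ?X))
        (add_mset (y1, B) ?Y)"
      by (simp add: add_mset_commute)
    then show ?thesis by (rule lbns_M[OF LogicM])
  qed
  from lbns_BoxR[OF y2(2) y1 y2(1) this] show ?case by simp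
next
  case (sq_AndL A B \<Gamma> \<Delta>)
  then show ?case using lbns_AndL[of R N x L A B] by simp
next
  case (sq_OrR \<Gamma> A B \<Delta>)
  then show ?case using lbns_OrR[of R N x L _ A B] by simp
qed (auto intro: lbns.intros)

lemma finite_g3_labels: "finite (g3_labels X Y)"
proof -
  have "finite (item_labels i)" for i by (cases i) auto
  then show ?thesis by (auto simp: g3_labels_def)
qed

lemma finite_g3_nlabels: "finite (g3_nlabels X Y)"
proof -
  have "finite (item_nlabels i)" for i by (cases i) auto
  then show ?thesis by (auto simp: g3_nlabels_def)
qed

text \<open>For a box step, \<open>Box A\<close> on the left yields a neighbourhood \<open>a\<close>
  standing for the worlds forcing \<open>A\<close>, which then serves as principal neighbourhood for
  \<open>Box B\<close> on the right.\<close>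

lemma sq_imp_g3:
  assumes "sq L \<Gamma> \<Delta>"
  shows "g3 L (image_mset (Lab x) \<Gamma> + X) (image_mset (Lab x) \<Delta> + Y)"
  using assms
proof (induction arbitrary: x X Y rule: sq.induct)
  case (sq_Box A B \<Gamma> \<Delta>)
  let ?X = "image_mset (Lab x) \<Gamma> + X" and ?Y = "image_mset (Lab x) \<Delta> + Y"
  obtain a where a: "a \<notin> g3_nlabels (add_mset (Lab x (Box A)) ?X) (add_mset (Lab x (Box B)) ?Y)"
    using ex_new_if_finite[OF infinite_UNIV_nat finite_g3_nlabels] by blast
  \<comment> \<open>Membership of \<open>z\<close> in \<open>a\<close> yields \<open>A\<close> at
    \<open>z\<close> through \<open>g3_ForcesAll\<close>, so the derivation of \<open>B\<close> from
    \<open>A\<close> can be replayed there.\<close>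
  have left: "g3 L (add_mset (Mem z a) (add_mset (ForcesAll a A) X'))
      (add_mset (Lab z B) Y')" for z X' Y'
    using g3_ForcesAll[of L z a A X' "add_mset (Lab z B) Y'"]
      sq_Box.IH(1)[of z "add_mset (Mem z a) (add_mset (ForcesAll a A) X')" Y']
    by (simp add: add_mset_commute)
  show ?case
  proof (cases L)
    case LogicE
    let ?Z = "add_mset (ForcesAll a A) (add_mset (Covers A a) ?X)"
    \<comment> \<open>A single fresh world serves as eigenvariable of both premises of
      \<open>g3_BoxR_E\<close>.\<close>
    obtain y where y: "y \<notin> g3_labels (add_mset (NbIn a x) ?Z) (add_mset (Lab x (Box B)) ?Y)"
      using ex_new_if_finite[OF infinite_UNIV_nat finite_g3_labels] by blast
    have 1: "g3 L (add_mset (Mem y a) (add_mset (NbIn a x) ?Z))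
        (add_mset (Lab y B) (add_mset (Lab x (Box B)) ?Y))"
      using left[of y "add_mset (NbIn a x) (add_mset (Covers A a) ?X)"]
      by (simp add: add_mset_commute)
    let ?W = "add_mset (Lab y B) (add_mset (NbIn a x) (add_mset (ForcesAll a A) ?X))"
      and ?V = "add_mset (Mem y a) (add_mset (Lab x (Box B)) ?Y)"
    \<comment> \<open>The rule for \<open>Covers\<close> is applied at \<open>y\<close>: one branch
      is the derivation of \<open>A\<close> from \<open>B\<close>, the other closes because
      \<open>y\<close> in \<open>a\<close> stands on both sides.\<close>
    have "g3 L (add_mset (Covers A a) ?W) (add_mset (Lab y A) ?V)"
      using sq_Box.IH(2)[OF LogicE, of y
          "add_mset (Covers A a) (add_mset (NbIn a x) (add_mset (ForcesAll a A) ?X))" ?V]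
      by (simp add: add_mset_commute)
    moreover have "g3 L (add_mset (Mem y a) (add_mset (Covers A a) ?W)) ?V"
      by (rule g3_init_Mem)
    ultimately have "g3 L (add_mset (Covers A a) ?W) ?V"
      by (rule g3_Covers[OF LogicE])
    then have 2: "g3 L (add_mset (Lab y B) (add_mset (NbIn a x) ?Z)) ?V"
      by (simp add: add_mset_commute)
    from g3_BoxL_E[OF LogicE a g3_BoxR_E[OF LogicE y y 1 2]] show ?thesis by simp
  next
    case LogicM
    let ?Z = "add_mset (ForcesAll a A) ?X"
    obtain y where y: "y \<notin> g3_labels (add_mset (NbIn a x) ?Z) (add_mset (Lab x (Box B)) ?Y)"
      using ex_new_if_finite[OF infinite_UNIV_nat finite_g3_labels] by blast
    have 1: "g3 L (add_mset (NbIn a x) (add_mset (Mem y a) ?Z))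
        (add_mset (Lab y B) (add_mset (Lab x (Box B)) ?Y))"
      using left[of y "add_mset (NbIn a x) ?X"] by (simp add: add_mset_commute)
    from g3_BoxL_M[OF LogicM a g3_BoxR_M[OF LogicM y 1]] show ?thesis by simp
  qed
next
  case (sq_AndL A B \<Gamma> \<Delta>)
  then show ?case using g3_AndL[of L x A B] by simp
next
  case (sq_OrR \<Gamma> A B \<Delta>)
  then show ?case using g3_OrR[of L _ x A B] by simp
qed (auto intro: g3.intros)


section \<open>Local sequents of LbNS\<close>

definition fms :: "lfm multiset \<Rightarrow> label \<Rightarrow> fm set" where
  "fms X y = {A. (y, A) \<in># X}"

lemma fms_add_mset:
  "fms (add_mset (x, A) X) y = (if x = y then insert A (fms X y) else fms X y)"
  by (auto simp: fms_def)

text \<open>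
  \<open>g y1\<close> remembers the formula \<open>B\<close> for which the pair \<open>(y1, y2)\<close> was created.
\<close>

definition pending :: "(label \<Rightarrow> fm) \<Rightarrow> rel set \<Rightarrow> label \<Rightarrow> fm set" where
  "pending g N y = {Box (g y1) |y1 y2. NbE y y1 y2 \<in> N}"

text \<open>
  Only the right box rule and the rule of the monotone system can act at an unfinished variable,
  so \<open>y1\<close> still carries just \<open>B\<close> (possibly pending), and so does \<open>y2\<close> in the system for E. The
  first clause makes the left box rule applicable at components only.
\<close>

definition lbns_inv ::
  "logic \<Rightarrow> label set \<Rightarrow> (label \<Rightarrow> fm) \<Rightarrow> rel set \<Rightarrow> lfm multiset \<Rightarrow> lfm multiset \<Rightarrow> bool" where
  "lbns_inv L R g N X Y \<longleftrightarrow>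
    (\<forall>y. \<not> component R N y \<longrightarrow> fms X y = {} \<or> fms Y y \<union> pending g N y = {}) \<and>
    (\<forall>x y1 y2. NbE x y1 y2 \<in> N \<longrightarrow>
      \<not> component R N y1 \<and> \<not> component R N y2 \<and> y1 \<noteq> y2 \<and>
      fms X y1 = {} \<and> fms Y y1 \<union> pending g N y1 \<subseteq> {g y1} \<and>
      fms Y y2 \<union> pending g N y2 = {} \<and> (L = LogicE \<longrightarrow> fms X y2 \<subseteq> {g y1})) \<and>
    (\<forall>x y1 y2 x' y1' y2'. NbE x y1 y2 \<in> N \<longrightarrow> NbE x' y1' y2' \<in> N \<longrightarrow>
      (x, y1, y2) = (x', y1', y2') \<or> {y1, y2} \<inter> {y1', y2'} = {})"

lemma lbns_invD:
  assumes "lbns_inv L R g N X Y"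
  shows "\<not> component R N y \<Longrightarrow> fms X y = {} \<or> fms Y y \<union> pending g N y = {}"
    and "NbE x y1 y2 \<in> N \<Longrightarrow> \<not> component R N y1 \<and> \<not> component R N y2 \<and> y1 \<noteq> y2 \<and>
      fms X y1 = {} \<and> fms Y y1 \<union> pending g N y1 \<subseteq> {g y1} \<and>
      fms Y y2 \<union> pending g N y2 = {} \<and> (L = LogicE \<longrightarrow> fms X y2 \<subseteq> {g y1})"
    and "NbE x y1 y2 \<in> N \<Longrightarrow> NbE x' y1' y2' \<in> N \<Longrightarrow>
      (x, y1, y2) = (x', y1', y2') \<or> {y1, y2} \<inter> {y1', y2'} = {}"
  using assms unfolding lbns_inv_def by metis+

lemma lbns_invI:
  assumes "\<And>y. \<not> component R N y \<Longrightarrow> fms X y = {} \<or> fms Y y \<union> pending g N y = {}"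
    and "\<And>x y1 y2. NbE x y1 y2 \<in> N \<Longrightarrow>
      \<not> component R N y1 \<and> \<not> component R N y2 \<and> y1 \<noteq> y2 \<and>
      fms X y1 = {} \<and> fms Y y1 \<union> pending g N y1 \<subseteq> {g y1} \<and>
      fms Y y2 \<union> pending g N y2 = {} \<and> (L = LogicE \<longrightarrow> fms X y2 \<subseteq> {g y1})"
    and "\<And>x y1 y2 x' y1' y2'. NbE x y1 y2 \<in> N \<Longrightarrow> NbE x' y1' y2' \<in> N \<Longrightarrow>
      (x, y1, y2) = (x', y1', y2') \<or> {y1, y2} \<inter> {y1', y2'} = {}"
  shows "lbns_inv L R g N X Y"
  unfolding lbns_inv_def using assms by metis

text \<open>The invariant restricts formulae only at labels that are not components, while every
  propositional rule acts at a component.\<close>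

lemma lbns_inv_local:
  assumes "lbns_inv L R g N X Y" "component R N x"
    and "\<And>y. y \<noteq> x \<Longrightarrow> fms X' y = fms X y" "\<And>y. y \<noteq> x \<Longrightarrow> fms Y' y = fms Y y"
  shows "lbns_inv L R g N X' Y'"
proof -
  have "fms X' y = fms X y" "fms Y' y = fms Y y" if "\<not> component R N y" for y
    using assms that by metis+
  then show ?thesis using assms(1) unfolding lbns_inv_def by metis
qed

text \<open>The witness must be a component, which keeps it away from unfinished and discarded
  variables. The map \<open>g\<close> is generalised because each right box inference extends it.
  The modal content sits in the left box case: either an old component works already, or both new
  ones do and together give a box inference at \<open>x\<close>.\<close>

lemma lbns_imp_cons:
  assumes "lbns L R N X Y" "lbns_inv L R g N X Y"
  shows "\<exists>c. component R N c \<and> cons L (fms X c) (fms Y c \<union> pending g N c)"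
  using assms
proof (induction arbitrary: g rule: lbns.induct)
  case (lbns_init N x p X Y)
  then show ?case by (intro exI[of _ x]) (auto simp: fms_add_mset intro: cons_common)
next
  case (lbns_BotL N x X Y)
  then show ?case by (intro exI[of _ x]) (auto simp: fms_add_mset intro: cons_Bot_left)
next
  case (lbns_AndL N x A B X Y)
  have inv: "lbns_inv L R g N (add_mset (x, A) (add_mset (x, B) X)) Y"
    by (rule lbns_inv_local[OF lbns_AndL.prems lbns_AndL.hyps(1)]) (auto simp: fms_add_mset)
  show ?case
    by (rule ex_merge[OF lbns_AndL.IH[OF inv] lbns_AndL.IH[OF inv], of x])
      (auto simp: fms_add_mset intro: cons_And_left)
next
  case (lbns_AndR N x X A Y B)
  have inv: "lbns_inv L R g N X (add_mset (x, A) Y)" "lbns_inv L R g N X (add_mset (x, B) Y)"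
    by (rule lbns_inv_local[OF lbns_AndR.prems lbns_AndR.hyps(1)]; auto simp: fms_add_mset)+
  show ?case
    by (rule ex_merge[OF lbns_AndR.IH(1)[OF inv(1)] lbns_AndR.IH(2)[OF inv(2)], of x])
      (auto simp: fms_add_mset intro: cons_And_right)
next
  case (lbns_OrL N x A X Y B)
  have inv: "lbns_inv L R g N (add_mset (x, A) X) Y" "lbns_inv L R g N (add_mset (x, B) X) Y"
    by (rule lbns_inv_local[OF lbns_OrL.prems lbns_OrL.hyps(1)]; auto simp: fms_add_mset)+
  show ?case
    by (rule ex_merge[OF lbns_OrL.IH(1)[OF inv(1)] lbns_OrL.IH(2)[OF inv(2)], of x])
      (auto simp: fms_add_mset intro: cons_Or_left)
next
  case (lbns_OrR N x X A B Y)
  have inv: "lbns_inv L R g N X (add_mset (x, A) (add_mset (x, B) Y))"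
    by (rule lbns_inv_local[OF lbns_OrR.prems lbns_OrR.hyps(1)]) (auto simp: fms_add_mset)
  show ?case
    by (rule ex_merge[OF lbns_OrR.IH[OF inv] lbns_OrR.IH[OF inv], of x])
      (auto simp: fms_add_mset intro: cons_Or_right)
next
  case (lbns_ImpL N x X A Y B)
  have inv: "lbns_inv L R g N X (add_mset (x, A) Y)" "lbns_inv L R g N (add_mset (x, B) X) Y"
    by (rule lbns_inv_local[OF lbns_ImpL.prems lbns_ImpL.hyps(1)]; auto simp: fms_add_mset)+
  show ?case
    by (rule ex_merge[OF lbns_ImpL.IH(1)[OF inv(1)] lbns_ImpL.IH(2)[OF inv(2)], of x])
      (auto simp: fms_add_mset intro: cons_Imp_left)
next
  case (lbns_ImpR N x A X B Y)
  have inv: "lbns_inv L R g N (add_mset (x, A) X) (add_mset (x, B) Y)"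
    by (rule lbns_inv_local[OF lbns_ImpR.prems lbns_ImpR.hyps(1)]) (auto simp: fms_add_mset)
  show ?case
    by (rule ex_merge[OF lbns_ImpR.IH[OF inv] lbns_ImpR.IH[OF inv], of x])
      (auto simp: fms_add_mset intro: cons_Imp_right)
next
  case (lbns_BoxR y1 y2 N X x B Y)
  let ?N = "insert (NbE x y1 y2) N" and ?g = "g(y1 := B)"
  let ?X = "add_mset (y2, B) X" and ?Y = "add_mset (y1, B) Y" and ?W = "add_mset (x, Box B) Y"
  note inv = lbns_invD[OF lbns_BoxR.prems]
  have fresh: "\<not> component R N y" "fms X y = {}" "fms Y y = {}" "x \<noteq> y"
      "\<And>u v. NbE u v y \<notin> N" "\<And>u v. NbE u y v \<notin> N" "\<And>u v. NbE y u v \<notin> N"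
    if "y \<notin> lbns_used R N X ?W" for y
    using that by (force simp: lbns_used_def component_def fms_def lfm_labels_def)+
  note f1 = fresh[OF lbns_BoxR.hyps(2)] and f2 = fresh[OF lbns_BoxR.hyps(3)]
  have comp: "component R ?N = component R N" by (auto simp: component_def fun_eq_iff)
  have pend: "pending ?g ?N y = (if y = x then insert (Box B) (pending g N y) else pending g N y)" for y
    unfolding pending_def using f1(6) by (auto; metis)
  have pend0: "pending g N y1 = {}" "pending g N y2 = {}"
    using f1 f2 by (auto simp: pending_def)
  \<comment> \<open>Away from \<open>y1\<close>, the premise keeps \<open>Box B\<close> as a pending
    formula where the conclusion has it in the succedent, so the right sides agree.\<close>
  have succ: "fms ?Y y \<union> pending ?g ?N y = fms ?W y \<union> pending g N y" if "y \<noteq> y1" for y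
    using that by (auto simp: fms_add_mset pend)
  have old: "v1 \<noteq> y1 \<and> v1 \<noteq> y2 \<and> v2 \<noteq> y1 \<and> v2 \<noteq> y2" if "NbE u v1 v2 \<in> N" for u v1 v2
    using that f1(5,6) f2(5,6) by blast
  have "lbns_inv L R ?g ?N ?X ?Y"
  proof (rule lbns_invI, unfold comp)
    fix y assume y: "\<not> component R N y"
    consider "y = y1" | "y = y2" | "y \<noteq> y1" "y \<noteq> y2" by blast
    then show "fms ?X y = {} \<or> fms ?Y y \<union> pending ?g ?N y = {}"
    proof cases
      case 1
      then show ?thesis using f1(2) lbns_BoxR.hyps(1) by (simp add: fms_add_mset)
    next
      case 2
      then show ?thesis using f2(3,4) pend0 lbns_BoxR.hyps(1) by (simp add: fms_add_mset pend)
    next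
      case 3
      then have "fms ?X y = fms X y" by (simp add: fms_add_mset)
      then show ?thesis using inv(1)[OF y] unfolding succ[OF 3(1)] by simp
    qed
  next
    fix u v1 v2 assume *: "NbE u v1 v2 \<in> ?N"
    consider "u = x" "v1 = y1" "v2 = y2"
      | "NbE u v1 v2 \<in> N" "v1 \<noteq> y1" "v1 \<noteq> y2" "v2 \<noteq> y1" "v2 \<noteq> y2"
      using * old[of u v1 v2] by blast
    then show "\<not> component R N v1 \<and> \<not> component R N v2 \<and> v1 \<noteq> v2 \<and>
      fms ?X v1 = {} \<and> fms ?Y v1 \<union> pending ?g ?N v1 \<subseteq> {?g v1} \<and>
      fms ?Y v2 \<union> pending ?g ?N v2 = {} \<and> (L = LogicE \<longrightarrow> fms ?X v2 \<subseteq> {?g v1})"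
    proof cases
      case 1
      then show ?thesis
        using f1 f2 pend0 lbns_BoxR.hyps(1) by (auto simp: fms_add_mset pend)
    next
      case 2
      then show ?thesis
        using inv(2)[OF 2(1)] unfolding succ[OF 2(2)] succ[OF 2(4)] by (simp add: fms_add_mset)
    qed
  next
    fix u v1 v2 u' v1' v2' assume *: "NbE u v1 v2 \<in> ?N" "NbE u' v1' v2' \<in> ?N"
    show "(u, v1, v2) = (u', v1', v2') \<or> {v1, v2} \<inter> {v1', v2'} = {}"
    proof (cases "NbE u v1 v2 \<in> N \<and> NbE u' v1' v2' \<in> N")
      case True
      then show ?thesis using inv(3) by blast
    next
      case False
      then show ?thesis using * old[of u v1 v2] old[of u' v1' v2'] by auto
    qed
  qed
  from lbns_BoxR.IH[OF this] obtain c where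
    c: "component R N c" "cons L (fms ?X c) (fms ?Y c \<union> pending ?g ?N c)"
    unfolding comp by blast
  then have "c \<noteq> y1" "c \<noteq> y2" using f1 f2 by auto
  with c succ[of c] show ?case by (auto simp: fms_add_mset)
next
  case (lbns_BoxL x y1 y2 N A X Y)
  let ?N = "insert (NbE x y1 y2) N" and ?X = "add_mset (x, Box A) X"
  note inv = lbns_invD[OF lbns_BoxL.prems]
  have pend: "pending g ?N y = (if y = x then insert (Box (g y1)) (pending g N y) else pending g N y)" for y
    by (auto simp: pending_def)
  have pend': "pending g (insert (Nb x z) N) = pending g N" for z
    by (auto simp: pending_def fun_eq_iff)
  have comp: "component R (insert (Nb x z) N) c \<longleftrightarrow> c = z \<or> component R ?N c" for z c
    by (auto simp: component_def)
  \<comment> \<open>At \<open>x\<close> there is \<open>Box A\<close> on the left and the pending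
    \<open>Box (g y1)\<close> on the right, which the invariant permits at components only.\<close>
  have x: "component R ?N x"
    using inv(1)[of x] by (auto simp: fms_add_mset pend)
  have pr: "\<not> component R ?N y1" "\<not> component R ?N y2" "y1 \<noteq> y2" "fms ?X y1 = {}"
      "fms Y y1 \<union> pending g ?N y1 \<subseteq> {g y1}" "fms Y y2 \<union> pending g ?N y2 = {}"
      "L = LogicE \<Longrightarrow> fms ?X y2 \<subseteq> {g y1}"
    using inv(2)[of x y1 y2] by blast+
  have ne: "y1 \<noteq> x" "y2 \<noteq> x" using x pr by auto
  have others: "v1 \<noteq> y1 \<and> v1 \<noteq> y2 \<and> v2 \<noteq> y1 \<and> v2 \<noteq> y2 \<and> v1 \<noteq> x \<and> v2 \<noteq> x \<and>
      \<not> component R ?N v1 \<and> \<not> component R ?N v2 \<and> v1 \<noteq> v2 \<and>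
      fms X v1 = {} \<and> fms Y v1 \<union> pending g N v1 \<subseteq> {g v1} \<and>
      fms Y v2 \<union> pending g N v2 = {} \<and> (L = LogicE \<longrightarrow> fms X v2 \<subseteq> {g v1})"
    if "NbE u v1 v2 \<in> N" for u v1 v2
  proof -
    have "(u, v1, v2) \<noteq> (x, y1, y2)" using that lbns_BoxL.hyps(1) by auto
    then have "{v1, v2} \<inter> {y1, y2} = {}"
      using inv(3)[of u v1 v2 x y1 y2] that by blast
    moreover have "\<not> component R ?N v1 \<and> \<not> component R ?N v2 \<and> v1 \<noteq> v2 \<and>
      fms ?X v1 = {} \<and> fms Y v1 \<union> pending g ?N v1 \<subseteq> {g v1} \<and>
      fms Y v2 \<union> pending g ?N v2 = {} \<and> (L = LogicE \<longrightarrow> fms ?X v2 \<subseteq> {g v1})"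
      by (rule inv(2)) (use that in blast)
    moreover from this x have "v1 \<noteq> x" "v2 \<noteq> x" by auto
    ultimately show ?thesis by (auto simp: fms_add_mset pend)
  qed
  have disj: "(u, v1, v2) = (u', v1', v2') \<or> {v1, v2} \<inter> {v1', v2'} = {}"
    if "NbE u v1 v2 \<in> N" "NbE u' v1' v2' \<in> N" for u v1 v2 u' v1' v2'
    by (rule inv(3)) (use that in blast)+
  \<comment> \<open>This covers the variable that a premise abandons: it stays outside the
    components with one side empty.\<close>
  have dead: "fms X y = {} \<or> fms Y y \<union> pending g N y = {}" if "\<not> component R ?N y" for y
  proof -
    have "fms ?X y = {} \<or> fms Y y \<union> pending g ?N y = {}" by (rule inv(1)[OF that])
    moreover have "y \<noteq> x" using that x by auto
    ultimately show ?thesis by (auto simp: fms_add_mset pend)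
  qed
  have weaken: "cons L (fms ?X c) (fms Y c \<union> pending g ?N c)"
    if "cons L (fms X c) (fms Y c \<union> pending g N c)" for c
    using that by (rule cons_mono) (auto simp: fms_add_mset pend)
  have "lbns_inv L R g (insert (Nb x y1) N) (add_mset (y1, A) X) Y"
    unfolding lbns_inv_def comp pend'
    using others disj dead by (auto simp: fms_add_mset)
  from lbns_BoxL.IH(1)[OF this] obtain c1 where c1: "c1 = y1 \<or> component R ?N c1"
    "cons L (fms (add_mset (y1, A) X) c1) (fms Y c1 \<union> pending g N c1)"
    unfolding comp pend' by blast
  have "lbns_inv L R g (insert (Nb x y2) N) X (add_mset (y2, A) Y)"
    unfolding lbns_inv_def comp pend'
    using others disj dead by (auto simp: fms_add_mset)
  from lbns_BoxL.IH(2)[OF this] obtain c2 where c2: "c2 = y2 \<or> component R ?N c2"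
    "cons L (fms X c2) (fms (add_mset (y2, A) Y) c2 \<union> pending g N c2)"
    unfolding comp pend' by blast
  show ?case
  proof (cases "c1 = y1")
    case False
    then show ?thesis using c1 weaken[of c1] by (auto simp: fms_add_mset)
  next
    case c1y: True
    \<comment> \<open>By the invariant the local sequent at \<open>y1\<close> contains at most
      \<open>A\<close> on the left and \<open>g y1\<close> on the right.\<close>
    have AB: "cons L {A} {g y1}"
      using c1(2) by (rule cons_mono) (use pr ne c1y in \<open>auto simp: fms_add_mset pend\<close>)
    show ?thesis
    proof (cases "c2 = y2")
      case False
      then show ?thesis using c2 weaken[of c2] by (auto simp: fms_add_mset)
    next
      case c2y: True
      \<comment> \<open>In E the variable \<open>y2\<close> carries at most \<open>g y1\<close> on
        the left. In M it may also carry a \<open>Bot\<close> from \<open>lbns_M\<close>, hence the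
        restriction.\<close>
      have BA: "cons L {g y1} {A}" if "L = LogicE"
        using c2(2) by (rule cons_mono) (use pr(6) pr(7)[OF that] ne c2y in \<open>auto simp: fms_add_mset pend\<close>)
      have "cons L (fms ?X x) (fms Y x \<union> pending g ?N x)"
        by (rule cons_Box[OF _ _ AB BA]) (auto simp: fms_add_mset pend)
      then show ?thesis using x by blast
    qed
  qed
next
  case (lbns_M x y1 y2 N X Y)
  let ?N = "insert (NbE x y1 y2) N"
  note inv = lbns_invD[OF lbns_M.prems]
  have pr: "\<not> component R ?N y2" "y1 \<noteq> y2" "fms Y y2 \<union> pending g ?N y2 = {}"
    using inv(2)[of x y1 y2] by blast+
  \<comment> \<open>Since pairs are disjoint, \<open>y2\<close> is the first variable of no pair, so
    the new \<open>Bot\<close> respects the empty left sides demanded there.\<close>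
  have ne: "v1 \<noteq> y2" if "NbE u v1 v2 \<in> ?N" for u v1 v2
  proof -
    have "(u, v1, v2) = (x, y1, y2) \<or> {v1, v2} \<inter> {y1, y2} = {}"
      by (rule inv(3)[OF that]) blast
    then show ?thesis using pr(2) by auto
  qed
  have "lbns_inv L R g ?N (add_mset (y2, Bot) X) Y"
  proof (rule lbns_invI)
    fix y assume "\<not> component R ?N y"
    then show "fms (add_mset (y2, Bot) X) y = {} \<or> fms Y y \<union> pending g ?N y = {}"
      using inv(1) pr(3) by (cases "y = y2") (simp_all add: fms_add_mset)
  next
    fix u v1 v2 assume *: "NbE u v1 v2 \<in> ?N"
    from inv(2)[OF *] ne[OF *] lbns_M.hyps(1)
    show "\<not> component R ?N v1 \<and> \<not> component R ?N v2 \<and> v1 \<noteq> v2 \<and>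
      fms (add_mset (y2, Bot) X) v1 = {} \<and> fms Y v1 \<union> pending g ?N v1 \<subseteq> {g v1} \<and>
      fms Y v2 \<union> pending g ?N v2 = {} \<and>
      (L = LogicE \<longrightarrow> fms (add_mset (y2, Bot) X) v2 \<subseteq> {g v1})"
      by (simp add: fms_add_mset)
  qed (rule inv(3))
  from lbns_M.IH[OF this] obtain c where "component R ?N c"
    "cons L (fms (add_mset (y2, Bot) X) c) (fms Y c \<union> pending g ?N c)" by blast
  moreover from this pr have "c \<noteq> y2" by auto
  ultimately show ?case by (auto simp: fms_add_mset)
qed


section \<open>Local sequents of G3\<close>

text \<open>
  \<open>f a\<close> is the formula whose extension the neighbourhood label \<open>a\<close> denotes.
\<close>

definition left_fms :: "(nlabel \<Rightarrow> fm) \<Rightarrow> item multiset \<Rightarrow> label \<Rightarrow> fm set" where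
  "left_fms f X y = {A. Lab y A \<in># X} \<union> {f a |a. Mem y a \<in># X} \<union> {Box (f a) |a. NbIn a y \<in># X}"

definition right_fms :: "(nlabel \<Rightarrow> fm) \<Rightarrow> item multiset \<Rightarrow> label \<Rightarrow> fm set" where
  "right_fms f Y y = {A. Lab y A \<in># Y} \<union> {f a |a. Mem y a \<in># Y}"

lemma left_fms_simps:
  "left_fms f (add_mset (Lab x A) X) y = (if x = y then insert A (left_fms f X y) else left_fms f X y)"
  "left_fms f (add_mset (Mem x a) X) y = (if x = y then insert (f a) (left_fms f X y) else left_fms f X y)"
  "left_fms f (add_mset (NbIn a x) X) y =
    (if x = y then insert (Box (f a)) (left_fms f X y) else left_fms f X y)"
  "left_fms f (add_mset (ForcesAll a A) X) y = left_fms f X y"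
  "left_fms f (add_mset (Covers A a) X) y = left_fms f X y"
  by (auto simp: left_fms_def)

lemma right_fms_simps:
  "right_fms f (add_mset (Lab x A) Y) y = (if x = y then insert A (right_fms f Y y) else right_fms f Y y)"
  "right_fms f (add_mset (Mem x a) Y) y = (if x = y then insert (f a) (right_fms f Y y) else right_fms f Y y)"
  by (auto simp: right_fms_def)

lemmas local_simps = left_fms_simps right_fms_simps

lemma local_fms_fresh:
  assumes "y \<notin> g3_labels X Y"
  shows "left_fms f X y = {}" "right_fms f Y y = {}"
  using assms by (force simp: left_fms_def right_fms_def g3_labels_def)+

lemma local_fms_fun_upd:
  assumes "a \<notin> g3_nlabels X Y"
  shows "left_fms (f(a := A)) X y = left_fms f X y" "right_fms (f(a := A)) Y y = right_fms f Y y"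
proof -
  have "Mem z b \<in># X \<Longrightarrow> b \<noteq> a" "Mem z b \<in># Y \<Longrightarrow> b \<noteq> a" "NbIn b z \<in># X \<Longrightarrow> b \<noteq> a" for b z
    using assms by (force simp: g3_nlabels_def)+
  then show "left_fms (f(a := A)) X y = left_fms f X y" "right_fms (f(a := A)) Y y = right_fms f Y y"
    unfolding left_fms_def right_fms_def by (auto; metis)+
qed

text \<open>Ties every neighbourhood label to a single formula, so that both kinds of atom merely
  describe the intended extension of \<open>a\<close>. Only antecedents matter, as no rule acts on
  these atoms on the right.\<close>

definition g3_inv :: "(nlabel \<Rightarrow> fm) \<Rightarrow> item multiset \<Rightarrow> bool" where
  "g3_inv f X \<longleftrightarrow> (\<forall>a A. ForcesAll a A \<in># X \<or> Covers A a \<in># X \<longrightarrow> A = f a)"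

lemma g3_inv_simps:
  "g3_inv f (add_mset (Lab x A) X) = g3_inv f X"
  "g3_inv f (add_mset (Mem x a) X) = g3_inv f X"
  "g3_inv f (add_mset (NbIn a x) X) = g3_inv f X"
  "g3_inv f (add_mset (ForcesAll a A) X) \<longleftrightarrow> A = f a \<and> g3_inv f X"
  "g3_inv f (add_mset (Covers A a) X) \<longleftrightarrow> A = f a \<and> g3_inv f X"
  by (auto simp: g3_inv_def)

lemma g3_inv_fun_upd:
  assumes "g3_inv f X" "a \<notin> g3_nlabels X Y"
  shows "g3_inv (f(a := A)) X"
  using assms unfolding g3_inv_def g3_nlabels_def by force

text \<open>Under the reading by \<open>f\<close>, \<open>g3_ForcesAll\<close> only repeats a
  formula, \<open>g3_init_Mem\<close> is identity, and a left box inference leaves all local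
  sequents unchanged once the fresh \<open>a\<close> is read as \<open>A\<close>; hence
  \<open>f\<close> is generalised.\<close>

lemma g3_imp_cons:
  assumes "g3 L X Y" "g3_inv f X"
  shows "\<exists>y. cons L (left_fms f X y) (right_fms f Y y)"
  using assms
proof (induction arbitrary: f rule: g3.induct)
  case (g3_init x p X Y)
  then show ?case by (intro exI[of _ x]) (auto simp: local_simps intro: cons_common)
next
  case (g3_BotL x X Y)
  then show ?case by (intro exI[of _ x]) (auto simp: local_simps intro: cons_Bot_left)
next
  case (g3_AndL x A B X Y)
  have "g3_inv f X" using g3_AndL.prems by (simp add: g3_inv_simps)
  then have inv: "g3_inv f (add_mset (Lab x A) (add_mset (Lab x B) X))" by (simp add: g3_inv_simps)
  show ?case
    by (rule ex_merge[OF g3_AndL.IH[OF inv] g3_AndL.IH[OF inv], of x])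
      (auto simp: local_simps intro: cons_And_left)
next
  case (g3_AndR X x A Y B)
  show ?case
    by (rule ex_merge[OF g3_AndR.IH(1)[OF g3_AndR.prems] g3_AndR.IH(2)[OF g3_AndR.prems], of x])
      (auto simp: local_simps intro: cons_And_right)
next
  case (g3_OrL x A X Y B)
  have "g3_inv f X" using g3_OrL.prems by (simp add: g3_inv_simps)
  then have inv: "g3_inv f (add_mset (Lab x C) X)" for C by (simp add: g3_inv_simps)
  show ?case
    by (rule ex_merge[OF g3_OrL.IH(1)[OF inv] g3_OrL.IH(2)[OF inv], of x])
      (auto simp: local_simps intro: cons_Or_left)
next
  case (g3_OrR X x A B Y)
  show ?case
    by (rule ex_merge[OF g3_OrR.IH[OF g3_OrR.prems] g3_OrR.IH[OF g3_OrR.prems], of x])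
      (auto simp: local_simps intro: cons_Or_right)
next
  case (g3_ImpL X x A Y B)
  have "g3_inv f X" using g3_ImpL.prems by (simp add: g3_inv_simps)
  then have inv: "g3_inv f (add_mset (Lab x B) X)" by (simp add: g3_inv_simps)
  show ?case
    by (rule ex_merge[OF g3_ImpL.IH(1)[OF \<open>g3_inv f X\<close>] g3_ImpL.IH(2)[OF inv], of x])
      (auto simp: local_simps intro: cons_Imp_left)
next
  case (g3_ImpR x A X B Y)
  then have inv: "g3_inv f (add_mset (Lab x A) X)" by (simp add: g3_inv_simps)
  show ?case
    by (rule ex_merge[OF g3_ImpR.IH[OF inv] g3_ImpR.IH[OF inv], of x])
      (auto simp: local_simps intro: cons_Imp_right)
next
  case (g3_init_Mem x a X Y)
  then show ?case by (intro exI[of _ x]) (auto simp: local_simps intro: cons_common)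
next
  case (g3_ForcesAll x a A X Y)
  then have A: "A = f a" by (simp add: g3_inv_simps)
  have "left_fms f (add_mset (Mem x a) (add_mset (Lab x A) (add_mset (ForcesAll a A) X))) y
      = left_fms f (add_mset (Mem x a) (add_mset (ForcesAll a A) X)) y" for y
    unfolding A by (simp add: local_simps)
  then show ?case using g3_ForcesAll.IH[of f] g3_ForcesAll.prems by (simp add: g3_inv_simps)
next
  case (g3_Covers A a X z Y)
  have A: "A = f a" using g3_Covers.prems by (simp add: g3_inv_simps)
  obtain y1 where y1: "cons L (left_fms f X y1) (right_fms f (add_mset (Lab z A) Y) y1)"
    using g3_Covers.IH(1)[OF g3_Covers.prems] by (auto simp: local_simps)
  obtain y2 where y2: "cons L (left_fms f (add_mset (Mem z a) X) y2) (right_fms f Y y2)"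
    using g3_Covers.IH(2)[of f] g3_Covers.prems by (auto simp: local_simps g3_inv_simps cong: if_cong)
  show ?case
    using y1 y2 A cons_cut[of L "left_fms f X z" A "right_fms f Y z"]
    by (auto simp: local_simps split: if_splits)
next
  case (g3_BoxL_E a x A X Y)
  have "g3_inv (f(a := A)) (add_mset (Lab x (Box A)) X)"
    by (rule g3_inv_fun_upd[OF g3_BoxL_E.prems g3_BoxL_E.hyps(2)])
  then have inv: "g3_inv (f(a := A)) (add_mset (NbIn a x) (add_mset (ForcesAll a A) (add_mset (Covers A a) X)))"
    by (simp add: g3_inv_simps)
  note upd = local_fms_fun_upd[OF g3_BoxL_E.hyps(2), of f A]
  have eq: "left_fms (f(a := A)) (add_mset (NbIn a x) (add_mset (ForcesAll a A) (add_mset (Covers A a) X))) y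
      = left_fms f (add_mset (Lab x (Box A)) X) y" for y
    unfolding upd(1)[symmetric] by (simp add: local_simps)
  from g3_BoxL_E.IH[OF inv] show ?case
    unfolding eq upd(2) .
next
  case (g3_BoxL_M a x A X Y)
  have "g3_inv (f(a := A)) (add_mset (Lab x (Box A)) X)"
    by (rule g3_inv_fun_upd[OF g3_BoxL_M.prems g3_BoxL_M.hyps(2)])
  then have inv: "g3_inv (f(a := A)) (add_mset (NbIn a x) (add_mset (ForcesAll a A) X))"
    by (simp add: g3_inv_simps)
  note upd = local_fms_fun_upd[OF g3_BoxL_M.hyps(2), of f A]
  have eq: "left_fms (f(a := A)) (add_mset (NbIn a x) (add_mset (ForcesAll a A) X)) y
      = left_fms f (add_mset (Lab x (Box A)) X) y" for y
    unfolding upd(1)[symmetric] by (simp add: local_simps)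
  from g3_BoxL_M.IH[OF inv] show ?case
    unfolding eq upd(2) .
next
  case (g3_BoxR_E y a x X B Y z)
  let ?X = "add_mset (NbIn a x) X" and ?Y = "add_mset (Lab x (Box B)) Y"
  obtain c1 where c1: "cons L (left_fms f (add_mset (Mem z a) ?X) c1) (right_fms f (add_mset (Lab z B) ?Y) c1)"
    using g3_BoxR_E.IH(1)[of f] g3_BoxR_E.prems by (auto simp: g3_inv_simps)
  obtain c2 where c2: "cons L (left_fms f (add_mset (Lab y B) ?X) c2) (right_fms f (add_mset (Mem y a) ?Y) c2)"
    using g3_BoxR_E.IH(2)[of f] g3_BoxR_E.prems by (auto simp: g3_inv_simps)
  note add = left_fms_simps(1,2)[of f _ _ ?X] right_fms_simps[of f _ _ ?Y]
  consider "c1 \<noteq> z" | "c2 \<noteq> y" | "c1 = z" "c2 = y" by blast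
  then show ?case
  proof cases
    case 1
    then show ?thesis using c1 unfolding add by auto
  next
    case 2
    then show ?thesis using c2 unfolding add by auto
  next
    case 3
    \<comment> \<open>At the fresh worlds nothing else is present, so the two local sequents are
      precisely the premises of the congruence rule for \<open>f a\<close> and
      \<open>B\<close>.\<close>
    have cons: "cons L {f a} {B}" "cons L {B} {f a}"
      using c1 c2 3 local_fms_fresh[OF g3_BoxR_E.hyps(2), of f] local_fms_fresh[OF g3_BoxR_E.hyps(3), of f]
      unfolding add by auto
    have "cons L (left_fms f ?X x) (right_fms f ?Y x)"
      by (rule cons_Box[OF _ _ cons]) (simp_all add: local_simps)
    then show ?thesis by blast
  qed
next
  case (g3_BoxR_M y a x X B Y)
  let ?X = "add_mset (NbIn a x) X" and ?Y = "add_mset (Lab x (Box B)) Y"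
  obtain c where c: "cons L (left_fms f (add_mset (Mem y a) ?X) c) (right_fms f (add_mset (Lab y B) ?Y) c)"
    using g3_BoxR_M.IH[of f] g3_BoxR_M.prems by (auto simp: g3_inv_simps add_mset_commute)
  note add = left_fms_simps(1,2)[of f _ _ ?X] right_fms_simps[of f _ _ ?Y]
  show ?case
  proof (cases "c = y")
    case False
    then show ?thesis using c unfolding add by auto
  next
    case True
    then have cons: "cons L {f a} {B}"
      using c local_fms_fresh[OF g3_BoxR_M.hyps(2), of f] unfolding add by auto
    have "cons L (left_fms f ?X x) (right_fms f ?Y x)"
      by (rule cons_Box[OF _ _ cons]) (simp_all add: local_simps g3_BoxR_M.hyps(1))
    then show ?thesis by blast
  qed
qed


section \<open>The equivalence\<close>

lemma at_decomposition:
  obtains \<Gamma> X' where "X = at x \<Gamma> + X'" "set_mset \<Gamma> = fms X x"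
proof
  have "at x (image_mset snd (filter_mset (\<lambda>i. fst i = x) X)) = filter_mset (\<lambda>i. fst i = x) X"
    by (induction X) auto
  then show "X = at x (image_mset snd (filter_mset (\<lambda>i. fst i = x) X)) + filter_mset (\<lambda>i. fst i \<noteq> x) X"
    by simp
  show "set_mset (image_mset snd (filter_mset (\<lambda>i. fst i = x) X)) = fms X x"
    by (force simp: fms_def)
qed

lemma items_at: "items (at x \<Gamma> + X) = image_mset (Lab x) \<Gamma> + items X"
  by (simp add: items_def image_mset.compositionality comp_def)

lemma g3_derivable_iff: "g3_derivable L X Y \<longleftrightarrow> (\<exists>x. cons L (fms X x) (fms Y x))"
proof
  assume "g3_derivable L X Y"
  moreover have "g3_inv f (items X)" for f
    by (auto simp: g3_inv_def items_def)
  \<comment> \<open>Without neighbourhood atoms the reading of neighbourhood labels is immaterial,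
    so the constant \<open>Bot\<close> will do.\<close>
  ultimately obtain x where "cons L (left_fms (\<lambda>_. Bot) (items X) x) (right_fms (\<lambda>_. Bot) (items Y) x)"
    using g3_imp_cons unfolding g3_derivable_def by blast
  moreover have "left_fms f (items X) x = fms X x" "right_fms f (items Y) x = fms Y x" for f
    by (force simp: left_fms_def right_fms_def fms_def items_def)+
  ultimately show "\<exists>x. cons L (fms X x) (fms Y x)" by auto
next
  assume "\<exists>x. cons L (fms X x) (fms Y x)"
  then obtain x where x: "cons L (fms X x) (fms Y x)" by blast
  obtain \<Gamma> X' where X: "X = at x \<Gamma> + X'" "set_mset \<Gamma> = fms X x" by (rule at_decomposition)
  obtain \<Delta> Y' where Y: "Y = at x \<Delta> + Y'" "set_mset \<Delta> = fms Y x" by (rule at_decomposition)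
  have "sq L \<Gamma> \<Delta>" using x X(2) Y(2) by (intro cons_imp_sq) simp
  then show "g3_derivable L X Y"
    unfolding g3_derivable_def X(1) Y(1) items_at by (rule sq_imp_g3)
qed

lemma lbns_derivable_iff: "lbns_derivable L X Y \<longleftrightarrow> (\<exists>x. cons L (fms X x) (fms Y x))"
proof
  assume "lbns_derivable L X Y"
  moreover have "lbns_inv L (lfm_labels X \<union> lfm_labels Y) g {} X Y" for g
    by (force simp: lbns_inv_def component_def fms_def lfm_labels_def)
  ultimately have "\<exists>c. cons L (fms X c) (fms Y c \<union> pending (\<lambda>_. Bot) {} c)"
    using lbns_imp_cons unfolding lbns_derivable_def by blast
  then show "\<exists>x. cons L (fms X x) (fms Y x)" by (simp add: pending_def)
next
  assume "\<exists>x. cons L (fms X x) (fms Y x)"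
  then obtain x where x: "cons L (fms X x) (fms Y x)" by blast
  obtain \<Gamma> X' where X: "X = at x \<Gamma> + X'" "set_mset \<Gamma> = fms X x" by (rule at_decomposition)
  obtain \<Delta> Y' where Y: "Y = at x \<Delta> + Y'" "set_mset \<Delta> = fms Y x" by (rule at_decomposition)
  have sq: "sq L \<Gamma> \<Delta>" using x X(2) Y(2) by (intro cons_imp_sq) simp
  \<comment> \<open>The empty sequent is not valid, so some formula is labelled by \<open>x\<close>;
    this makes \<open>x\<close> a root and hence a component.\<close>
  have "fms X x \<noteq> {} \<or> fms Y x \<noteq> {}" using x not_cons_empty by auto
  then have "component (lfm_labels X \<union> lfm_labels Y) {} x"
    by (force simp: component_def fms_def lfm_labels_def)
  then have "lbns L (lfm_labels X \<union> lfm_labels Y) {} (at x \<Gamma> + X') (at x \<Delta> + Y')"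
    by (intro sq_imp_lbns[OF sq]) (auto simp: lfm_labels_def)
  then show "lbns_derivable L X Y"
    using X(1) Y(1) by (simp add: lbns_derivable_def)
qed

theorem theorem9:
  shows "(\<forall>X Y :: lfm multiset. g3_derivable LogicE X Y \<longleftrightarrow> lbns_derivable LogicE X Y) \<and>
         (\<forall>X Y :: lfm multiset. g3_derivable LogicM X Y \<longleftrightarrow> lbns_derivable LogicM X Y)"
  by (simp add: g3_derivable_iff lbns_derivable_iff)

end
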